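(* Let an SDIRK method with non-negative weights $b_j\ge 0$, order $p$ and stage order $q$ be used as predictor for the graph Laplacian system $\mathbf{y}'=\mathbf{G}(\mathbf{y})\,\mathbf{y}$. Starting from the exact solution $\mathbf{y}_n=\mathbf{y}(t_n)\succeq 0$, let $\mathbf{Y}_1,\dots,\mathbf{Y}_s$ and $\mathbf{y}^{\{p\}}_{n+1}$ be the predictor stages and predicted solution with step size $h$, $$\mathbf{Y}_i=\mathbf{y}_n+h\sum_{j=1}^{i}a_{i,j}\,\mathbf{G}(\mathbf{Y}_j)\,\mathbf{Y}_j\ \ (i=1,\dots,s),\qquad \mathbf{y}^{\{p\}}_{n+1}=\mathbf{y}_n+h\sum_{j=1}^{s}b_j\,\mathbf{G}(\mathbf{Y}_j)\,\mathbf{Y}_j,$$ and let the corrected solution $\mathbf{y}_{n+1}$ be defined by $$\mathbf{y}_{n+1}=\mathbf{y}_n+h\,\overline{\mathbf{G}}\,\mathbf{y}_{n+1},\qquad \overline{\mathbf{G}}=\sum_{j=1}^{s}b_j\,\mathbf{G}(\breve{\mathbf{Y}}_j)\,\boldsymbol{\Sigma}_{\mathbf{Y}_j/\mathbf{y}^{\{p\}}_{n+1}},$$ where $\varepsilon>0$ is the threshold used in the ratio scaling matrices $\boldsymbol{\Sigma}$. Then the local truncation error of the corrected solution is $$\mathbf{y}_{n+1}-\mathbf{y}(t_{n+1})=\mathcal{O}\big(h^{\min(q+2,\,p+1)}\big)+\mathcal{O}(\varepsilon).$$ Moreover, at each step one can select the threshold depending on the current step size as $\varepsilon=C\,h^{\min(q+2,\,p+1)}$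 with a constant $C>0$ independent of the step, and with this choice the order of the corrected method is $\min(p,q+1)$.
   Context: Notation: $\succeq$ denotes the component-wise inequality for vectors; $t_{n+1}=t_n+h$. System: $\mathbf{y}'=\mathbf{f}(t,\mathbf{y})=\mathbf{G}(t,\mathbf{y})\,\mathbf{y}$, $\mathbf{y}(t_0)=\mathbf{y}_0\succeq 0$ in $\mathbb{R}^d$, with $\mathbf{G}(t,\mathbf{y})\in\mathbb{R}^{d\times d}$; in the numerical formulas the argument $t$ is suppressed. Standing assumptions on $\mathbf{G}$: (i) the eigenvalues of $\mathbf{G}(t,\mathbf{y})$ have non-positive real parts for all $t,\mathbf{y}$; (ii) $\mathbf{G}_{i,i}(t,\mathbf{y})\le 0$ for all $i$ and $\mathbf{G}_{i,j}(t,\mathbf{y})\ge 0$ for all $i\ne j$, for all $t\ge t_0$ and all $\mathbf{y}\succeq 0$; (iii) there are vectors $\mathbf{w}_1,\dots,\mathbf{w}_M\in\mathbb{R}^d$, $M<d$, with $\mathbf{w}_j^T\mathbf{G}(t,\mathbf{y})=\mathbf{0}$ for all $t,\mathbf{y}$, and $\mathbf{w}_1=\boldsymbol{1}_d$ is the vector of ones (all column sums of $\mathbf{G}$ vanish). Exact solutions started from non-negative data remain non-negative. $\mathbf{G}$ and the exact solution are assumed as smooth as needed for the order statements. SDIRK method: $s$-stage singly diagonally implicit Runge-Kutta method with coefficients $a_{i,j}$ ($j\le i$), equal diagonal entries $a_{i,i}$, weights $b_j\ge 0$, abscissae $c_i$, and stiffly accurate: $b_j=a_{s,j}$ for all $j$.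 For small $h$ the stages are the solutions of the implicit stage equations that tend to $\mathbf{y}_n$ as $h\to 0$. Order $p$ means that, starting from the exact solution at $t_n$, the one-step (local) error at $t_{n+1}$ is $\mathcal{O}(h^{p+1})$; stage order $q$ means that the errors $\mathbf{Y}_i-\mathbf{y}(t_n+c_ih)$ are $\mathcal{O}(h^{q+1})$ for all $i$. The order of the corrected method is understood in the same sense (local truncation error $\mathcal{O}(h^{r+1})$ corresponds to order $r$). Clipping: $\breve{\mathbf{Y}}=\mathrm{clip}(\mathbf{Y})$ has components $\breve{\mathbf{Y}}_\ell=\max(\mathbf{Y}_\ell,0)$, $\ell=1,\dots,d$. Ratio scaling: for $\mathbf{Y},\mathbf{Z}\in\mathbb{R}^d$ and threshold $\varepsilon>0$, $\boldsymbol{\Sigma}_{\mathbf{Y}/\mathbf{Z}}=\mathrm{diag}_{\ell=1,\dots,d}\ \dfrac{\max(\mathbf{Y}_\ell,0)}{\max(\mathbf{Z}_\ell,\varepsilon)}\in\mathbb{R}^{d\times d}$. The $\mathcal{O}(\cdot)$ terms are for $h\to 0$ and $\varepsilon\to 0$, with constants independent of $h$ and $\varepsilon$. *)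

theory Defs
  imports "HOL-Analysis.Analysis" "HOL-Library.Landau_Symbols"
begin

section \<open>Graph Laplacian systems\<close>

definition eigenvalue_of :: "real^'d^'d \<Rightarrow> complex \<Rightarrow> bool" where
  "eigenvalue_of A \<mu> \<longleftrightarrow>
    (\<exists>v::complex^'d. v \<noteq> 0 \<and> map_matrix complex_of_real A *v v = \<mu> *s v)"

definition graph_laplacian :: "real \<Rightarrow> (real \<Rightarrow> real^'d \<Rightarrow> real^'d^'d) \<Rightarrow> bool" where
  "graph_laplacian t0 G \<longleftrightarrow>
    (\<forall>t y \<mu>. eigenvalue_of (G t y) \<mu> \<longrightarrow> Re \<mu> \<le> 0) \<and>
    (\<forall>t\<ge>t0. \<forall>y\<ge>0. (\<forall>i. G t y $ i $ i \<le> 0) \<and> (\<forall>i j. i \<noteq> j \<longrightarrow> 0 \<le> G t y $ i $ j)) \<and>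
    (\<exists>M (w :: nat \<Rightarrow> real^'d). 1 \<le> M \<and> M < CARD('d) \<and> w 1 = (\<chi> i. 1) \<and>
       (\<forall>j\<in>{1..M}. \<forall>t y. w j v* G t y = 0))"

definition C1_on :: "('a::real_normed_vector \<Rightarrow> 'b::real_normed_vector) \<Rightarrow> 'a set \<Rightarrow> bool" where
  "C1_on f S \<longleftrightarrow>
    (\<exists>f' :: 'a \<Rightarrow> 'a \<Rightarrow>\<^sub>L 'b. continuous_on S f' \<and>
       (\<forall>x\<in>S. (f has_derivative blinfun_apply (f' x)) (at x within S)))"

definition Ck_curve_on :: "nat \<Rightarrow> (real \<Rightarrow> 'a::real_normed_vector) \<Rightarrow> real set \<Rightarrow> bool" where
  "Ck_curve_on k f S \<longleftrightarrow>
    (\<exists>D :: nat \<Rightarrow> real \<Rightarrow> 'a. (\<forall>t\<in>S. D 0 t = f t) \<and>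
       (\<forall>i<k. \<forall>t\<in>S. (D i has_vector_derivative D (Suc i) t) (at t within S)) \<and>
       continuous_on S (D k))"

definition exact_solution ::
  "real \<Rightarrow> (real \<Rightarrow> real^'d \<Rightarrow> real^'d^'d) \<Rightarrow> real^'d \<Rightarrow> (real \<Rightarrow> real^'d) \<Rightarrow> bool" where
  "exact_solution t0 G y0 y \<longleftrightarrow> y t0 = y0 \<and>
    (\<forall>t\<ge>t0. (y has_vector_derivative (G t (y t) *v y t)) (at t within {t0..}))"

section \<open>One step of the predictor and of the corrector\<close>

text \<open>Stages are indexed by \<open>1..s\<close>. The stage time \<open>tn + c j * h\<close> is the time argument of
  the \<open>j\<close>-th stage evaluation of a non-autonomous \<open>G\<close>.\<close>

definition sdirk :: "nat \<Rightarrow> (nat \<Rightarrow> nat \<Rightarrow> real) \<Rightarrow> (nat \<Rightarrow> real) \<Rightarrow> bool" where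
  "sdirk s a b \<longleftrightarrow> 1 \<le> s \<and>
    (\<forall>i\<in>{1..s}. \<forall>j\<in>{1..s}. i < j \<longrightarrow> a i j = 0) \<and>
    (\<forall>i\<in>{1..s}. \<forall>j\<in>{1..s}. a i i = a j j) \<and>
    (\<forall>j\<in>{1..s}. b j = a s j)"

definition stage_equations ::
  "(real \<Rightarrow> real^'d \<Rightarrow> real^'d^'d) \<Rightarrow> nat \<Rightarrow> (nat \<Rightarrow> nat \<Rightarrow> real) \<Rightarrow> (nat \<Rightarrow> real) \<Rightarrow>
    real \<Rightarrow> real \<Rightarrow> real^'d \<Rightarrow> (nat \<Rightarrow> real^'d) \<Rightarrow> bool" where
  "stage_equations G s a c tn h yn Y \<longleftrightarrow>
    (\<forall>i\<in>{1..s}. Y i = yn + h *\<^sub>R (\<Sum>j=1..i. a i j *\<^sub>R (G (tn + c j * h) (Y j) *v Y j)))"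

definition predicted ::
  "(real \<Rightarrow> real^'d \<Rightarrow> real^'d^'d) \<Rightarrow> nat \<Rightarrow> (nat \<Rightarrow> real) \<Rightarrow> (nat \<Rightarrow> real) \<Rightarrow>
    real \<Rightarrow> real \<Rightarrow> real^'d \<Rightarrow> (nat \<Rightarrow> real^'d) \<Rightarrow> real^'d" where
  "predicted G s b c tn h yn Y =
    yn + h *\<^sub>R (\<Sum>j=1..s. b j *\<^sub>R (G (tn + c j * h) (Y j) *v Y j))"

definition clip :: "real^'d \<Rightarrow> real^'d" where
  "clip Y = (\<chi> l. max (Y $ l) 0)"

definition ratio_scaling :: "real \<Rightarrow> real^'d \<Rightarrow> real^'d \<Rightarrow> real^'d^'d" where
  "ratio_scaling \<epsilon> Y Z = (\<chi> k l. if k = l then max (Y $ l) 0 / max (Z $ l) \<epsilon> else 0)"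

definition G_bar ::
  "(real \<Rightarrow> real^'d \<Rightarrow> real^'d^'d) \<Rightarrow> nat \<Rightarrow> (nat \<Rightarrow> real) \<Rightarrow> (nat \<Rightarrow> real) \<Rightarrow>
    real \<Rightarrow> real \<Rightarrow> real \<Rightarrow> (nat \<Rightarrow> real^'d) \<Rightarrow> real^'d \<Rightarrow> real^'d^'d" where
  "G_bar G s b c tn h \<epsilon> Y yp =
    (\<Sum>j=1..s. b j *\<^sub>R (G (tn + c j * h) (clip (Y j)) ** ratio_scaling \<epsilon> (Y j) yp))"

definition corrector_equation ::
  "(real \<Rightarrow> real^'d \<Rightarrow> real^'d^'d) \<Rightarrow> nat \<Rightarrow> (nat \<Rightarrow> real) \<Rightarrow> (nat \<Rightarrow> real) \<Rightarrow>
    real \<Rightarrow> real \<Rightarrow> real \<Rightarrow> real^'d \<Rightarrow> (nat \<Rightarrow> real^'d) \<Rightarrow> real^'d \<Rightarrow> real^'d \<Rightarrow> bool" where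
  "corrector_equation G s b c tn h \<epsilon> yn Y yp u \<longleftrightarrow>
    u = yn + h *\<^sub>R (G_bar G s b c tn h \<epsilon> Y yp *v u)"

section \<open>Orders\<close>

text \<open>Steps \<open>(tn, h)\<close> with \<open>h\<close> tending to \<open>0\<close> from the right, uniformly over the starting times
  \<open>tn\<close> in \<open>TN\<close>. Statements for one fixed starting time are the case of a singleton \<open>TN\<close>.\<close>

definition steps :: "real set \<Rightarrow> (real \<times> real) filter" where
  "steps TN = principal TN \<times>\<^sub>F at_right 0"

text \<open>\<open>z tn h\<close> is the result of one step of size \<open>h\<close> started from the exact value \<open>y tn\<close>.\<close>

definition local_order ::
  "real set \<Rightarrow> (real \<Rightarrow> real^'d) \<Rightarrow> (real \<Rightarrow> real \<Rightarrow> real^'d) \<Rightarrow> nat \<Rightarrow> bool" where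
  "local_order TN y z r \<longleftrightarrow>
    (\<lambda>(tn, h). norm (z tn h - y (tn + h))) \<in> O[steps TN](\<lambda>(tn, h). h ^ (r + 1))"

definition stage_order ::
  "real set \<Rightarrow> (real \<Rightarrow> real^'d) \<Rightarrow> nat \<Rightarrow> (nat \<Rightarrow> real) \<Rightarrow>
    (real \<Rightarrow> real \<Rightarrow> nat \<Rightarrow> real^'d) \<Rightarrow> nat \<Rightarrow> bool" where
  "stage_order TN y s c Y q \<longleftrightarrow>
    (\<forall>i\<in>{1..s}. (\<lambda>(tn, h). norm (Y tn h i - y (tn + c i * h))) \<in> O[steps TN](\<lambda>(tn, h). h ^ (q + 1)))"

end

theory Submission
  imports Defs
begin

text \<open>The matrix of the corrector has non-negative off-diagonal entries and vanishing column sums, so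
  the inverse of \<open>I - h G_bar\<close> has \<open>\<ell>\<^sup>1\<close>-norm at most 1, however large the scaling ratios are. The
  corrected value minus the clipped prediction is thus bounded by the defect of the clipped prediction.
  Its only delicate contribution comes from components where the prediction is below \<open>\<epsilon>\<close>: there
  the stage values themselves must be shown to be \<open>O(\<epsilon> + h^(p+1) + h^(q+1))\<close>. Since
  \<open>y\<^sub>l' \<ge> -K y\<^sub>l\<close>, smallness of \<open>y\<^sub>l\<close> at \<open>tn + h\<close> propagates backwards in time, and by smoothness
  it extrapolates from \<open>[tn, tn + h]\<close> to stage times beyond \<open>tn + h\<close>.\<close>

section \<open>Clipping and M-matrices\<close>

lemma norm_clip_diff_le:
  fixes x y :: "real^'d"
  shows "norm (clip x - clip y) \<le> norm (x - y)"
  by (rule norm_le_componentwise_cart) (simp add: clip_def max_def)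

lemma clip_nonneg: "0 \<le> clip x"
  by (simp add: clip_def less_eq_vec_def)

lemma clip_eq_self: "0 \<le> x \<Longrightarrow> clip x = x"
  by (simp add: clip_def less_eq_vec_def vec_eq_iff)

lemma norm_clip_le: "norm (clip x) \<le> norm x"
  by (rule norm_le_componentwise_cart) (simp add: clip_def max_def)

text \<open>Clipping moves only negative components, and such a component is at least its own
  absolute value away from a non-negative \<open>z\<close>. With the exact solution as
  \<open>z\<close>, clipping a numerical value costs no more than the error it already has.\<close>

lemma norm_clip_diff_self_le:
  fixes x z :: "real^'d"
  assumes "0 \<le> z"
  shows "norm (clip x - x) \<le> norm (x - z)"
proof (rule norm_le_componentwise_cart)
  fix l
  have "0 \<le> z $ l"
    using assms by (simp add: less_eq_vec_def)
  then show "norm ((clip x - x) $ l) \<le> norm ((x - z) $ l)"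
    by (simp add: clip_def max_def)
qed

lemma matrix_vector_component_le:
  fixes A :: "real^'n^'m" and x :: "real^'n"
  shows "\<bar>(A *v x) $ l\<bar> \<le> norm A * norm x"
proof -
  have "\<bar>(A *v x) $ l\<bar> = \<bar>A $ l \<bullet> x\<bar>"
    by (simp add: matrix_vector_mul_component)
  also have "\<dots> \<le> norm (A $ l) * norm x"
    by (rule Cauchy_Schwarz_ineq2)
  also have "\<dots> \<le> norm A * norm x"
    by (intro mult_right_mono Finite_Cartesian_Product.norm_nth_le norm_ge_zero)
  finally show ?thesis .
qed

text \<open>The absolute values satisfy \<open>\<bar>v\<bar> \<le> \<bar>r\<bar> + h A \<bar>v\<bar>\<close> componentwise, and summation removes the
  last term because the column sums of \<open>A\<close> vanish.\<close>

lemma l1_resolvent_le: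
  fixes A :: "real^'n^'n" and v r :: "real^'n"
  assumes "0 \<le> h" and diag: "\<And>l. A $ l $ l \<le> 0"
    and off_diag: "\<And>l k. l \<noteq> k \<Longrightarrow> 0 \<le> A $ l $ k"
    and column_sums: "\<And>k. (\<Sum>l\<in>UNIV. A $ l $ k) = 0"
    and eq: "v = r + h *\<^sub>R (A *v v)"
  shows "(\<Sum>l\<in>UNIV. \<bar>v $ l\<bar>) \<le> (\<Sum>l\<in>UNIV. \<bar>r $ l\<bar>)"
proof -
  have comp: "\<bar>v $ l\<bar> \<le> \<bar>r $ l\<bar> + h * (\<Sum>k\<in>UNIV. A $ l $ k * \<bar>v $ k\<bar>)" for l
  proof -
    have split: "(\<Sum>k\<in>UNIV. A $ l $ k * g k) = A $ l $ l * g l + (\<Sum>k\<in>UNIV - {l}. A $ l $ k * g k)"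
      for g :: "'n \<Rightarrow> real"
      by (simp add: sum.remove)
    have "v $ l = r $ l + h * (\<Sum>k\<in>UNIV. A $ l $ k * v $ k)"
      by (subst eq) (simp add: matrix_vector_mult_def)
    then have "v $ l = r $ l + h * (A $ l $ l * v $ l + (\<Sum>k\<in>UNIV - {l}. A $ l $ k * v $ k))"
      by (simp only: split)
    \<comment> \<open>With the diagonal term on the left the factor \<open>1 - h * A $ l $ l\<close>
      is at least 1, so it passes through the absolute value unchanged; on the right only
      non-negative entries of \<open>A\<close> remain.\<close>
    then have "(1 - h * A $ l $ l) * v $ l = r $ l + h * (\<Sum>k\<in>UNIV - {l}. A $ l $ k * v $ k)"
      by (simp add: algebra_simps)
    then have "\<bar>(1 - h * A $ l $ l) * v $ l\<bar> \<le> \<bar>r $ l\<bar> + \<bar>h * (\<Sum>k\<in>UNIV - {l}. A $ l $ k * v $ k)\<bar>"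
      by simp
    also have "\<bar>h * (\<Sum>k\<in>UNIV - {l}. A $ l $ k * v $ k)\<bar> \<le> h * (\<Sum>k\<in>UNIV - {l}. A $ l $ k * \<bar>v $ k\<bar>)"
    proof -
      have "\<bar>\<Sum>k\<in>UNIV - {l}. A $ l $ k * v $ k\<bar> \<le> (\<Sum>k\<in>UNIV - {l}. \<bar>A $ l $ k * v $ k\<bar>)"
        by (rule sum_abs)
      also have "\<dots> = (\<Sum>k\<in>UNIV - {l}. A $ l $ k * \<bar>v $ k\<bar>)"
        by (rule sum.cong) (auto simp: abs_mult off_diag)
      finally show ?thesis
        using \<open>0 \<le> h\<close> by (simp add: abs_mult mult_left_mono)
    qed
    also have "\<bar>(1 - h * A $ l $ l) * v $ l\<bar> = (1 - h * A $ l $ l) * \<bar>v $ l\<bar>"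
    proof -
      have "h * A $ l $ l \<le> 0"
        using \<open>0 \<le> h\<close> diag by (simp add: mult_nonneg_nonpos)
      then show ?thesis
        by (simp add: abs_mult)
    qed
    finally show ?thesis
      unfolding split by (simp add: algebra_simps)
  qed
  have "(\<Sum>l\<in>UNIV. \<bar>v $ l\<bar>)
      \<le> (\<Sum>l\<in>UNIV. \<bar>r $ l\<bar> + h * (\<Sum>k\<in>UNIV. A $ l $ k * \<bar>v $ k\<bar>))"
    by (intro sum_mono comp)
  also have "\<dots> = (\<Sum>l\<in>UNIV. \<bar>r $ l\<bar>) + h * (\<Sum>k\<in>UNIV. \<Sum>l\<in>UNIV. A $ l $ k * \<bar>v $ k\<bar>)"
    by (subst sum.swap) (simp add: sum.distrib sum_distrib_left)
  also have "\<dots> = (\<Sum>l\<in>UNIV. \<bar>r $ l\<bar>)"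
    by (simp add: column_sums flip: sum_distrib_right)
  finally show ?thesis .
qed

section \<open>Extrapolation of small functions\<close>

text \<open>The induction passes from \<open>f\<close> to its forward difference \<open>f (t + \<eta>) - f t\<close>, whose \<open>n\<close>-th
  derivative is at most \<open>M * \<eta>\<close>.\<close>

lemma extrapolation_step:
  fixes D :: "nat \<Rightarrow> real \<Rightarrow> real"
  assumes "0 < \<eta>"
    and "\<And>i t. i < n \<Longrightarrow> t \<in> {x..x + real n * \<eta>} \<Longrightarrow>
      (D i has_real_derivative D (Suc i) t) (at t within {x..x + real n * \<eta>})"
    and "\<And>t. t \<in> {x..x + real n * \<eta>} \<Longrightarrow> \<bar>D n t\<bar> \<le> M"
    and "\<And>i. i < n \<Longrightarrow> \<bar>D 0 (x + real i * \<eta>)\<bar> \<le> \<delta>"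
  shows "\<bar>D 0 (x + real n * \<eta>)\<bar> \<le> M * \<eta> ^ n + (2 ^ n - 1) * \<delta>"
  using assms(2-)
proof (induction n arbitrary: D M \<delta>)
  case 0
  then show ?case by simp
next
  case (Suc n)
  let ?I = "{x..x + real (Suc n) * \<eta>}" and ?J = "{x..x + real n * \<eta>}"
  define E where "E i t = D i (t + \<eta>) - D i t" for i t
  have sub: "?J \<subseteq> ?I" and shift: "(\<lambda>t. t + \<eta>) ` ?J \<subseteq> ?I"
    using \<open>0 < \<eta>\<close> by (auto simp: algebra_simps)
  have E_deriv: "(E i has_real_derivative E (Suc i) t) (at t within ?J)" if "i < n" "t \<in> ?J" for i t
  proof -
    have "(D i has_real_derivative D (Suc i) t) (at t within ?J)"
      using Suc.prems(1)[of i t] that sub by (meson DERIV_subset less_SucI subsetD)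
    moreover have "((\<lambda>t. D i (t + \<eta>)) has_real_derivative D (Suc i) (t + \<eta>) * 1) (at t within ?J)"
    proof (rule DERIV_image_chain[where g = "\<lambda>t. t + \<eta>" and f = "D i", unfolded o_def])
      show "(D i has_real_derivative D (Suc i) (t + \<eta>)) (at (t + \<eta>) within (\<lambda>t. t + \<eta>) ` ?J)"
        using Suc.prems(1)[of i "t + \<eta>"] that shift
        by (meson DERIV_subset image_eqI less_SucI subsetD)
    qed (auto intro!: derivative_eq_intros)
    ultimately show ?thesis
      unfolding E_def by (auto intro!: derivative_eq_intros)
  qed
  have E_bound: "\<bar>E n t\<bar> \<le> M * \<eta>" if "t \<in> ?J" for t
  proof -
    have t_sub: "{t..t + \<eta>} \<subseteq> ?I"
      using that \<open>0 < \<eta>\<close> by (auto simp: algebra_simps)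
    have "\<exists>\<xi>\<in>{t<..<t + \<eta>}. D n (t + \<eta>) - D n t = (\<lambda>d. D (Suc n) \<xi> * d) (t + \<eta> - t)"
    proof (rule mvt_simple)
      fix \<xi> assume "t \<le> \<xi>" "\<xi> \<le> t + \<eta>"
      then have "(D n has_real_derivative D (Suc n) \<xi>) (at \<xi> within {t..t + \<eta>})"
        using Suc.prems(1)[of n \<xi>] t_sub by (meson DERIV_subset lessI atLeastAtMost_iff subsetD)
      then show "(D n has_derivative (\<lambda>d. D (Suc n) \<xi> * d)) (at \<xi> within {t..t + \<eta>})"
        by (simp add: has_field_derivative_def)
    qed (use \<open>0 < \<eta>\<close> in simp)
    then obtain \<xi> where "\<xi> \<in> {t<..<t + \<eta>}" "E n t = D (Suc n) \<xi> * \<eta>"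
      by (auto simp: E_def)
    moreover have "\<bar>D (Suc n) \<xi>\<bar> \<le> M"
      using Suc.prems(2)[of \<xi>] t_sub \<open>\<xi> \<in> _\<close> by auto
    ultimately show ?thesis
      using \<open>0 < \<eta>\<close> by (simp add: abs_mult)
  qed
  have E_small: "\<bar>E 0 (x + real i * \<eta>)\<bar> \<le> 2 * \<delta>" if "i < n" for i
    using Suc.prems(3)[of i] Suc.prems(3)[of "Suc i"] that
    by (simp add: E_def algebra_simps)
  \<comment> \<open>The differences start from the bound \<open>2 * \<delta>\<close>, and recovering
    \<open>D 0\<close> from its difference costs one more \<open>\<delta>\<close>; this turns
    \<open>2 ^ n - 1\<close> into \<open>2 * (2 ^ n - 1) + 1\<close>.\<close>
  have "\<bar>E 0 (x + real n * \<eta>)\<bar> \<le> M * \<eta> * \<eta> ^ n + (2 ^ n - 1) * (2 * \<delta>)"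
    by (rule Suc.IH[OF E_deriv E_bound E_small])
  moreover have "\<bar>D 0 (x + real n * \<eta>)\<bar> \<le> \<delta>"
    by (rule Suc.prems(3)) simp
  moreover have "D 0 (x + real (Suc n) * \<eta>) = E 0 (x + real n * \<eta>) + D 0 (x + real n * \<eta>)"
    by (simp add: E_def algebra_simps)
  ultimately show ?case
    by (simp add: algebra_simps)
qed

text \<open>The bound on \<open>{A..A + h}\<close> is carried to the right in \<open>m\<close>
  strides of length \<open>h / n\<close>. Each stride extrapolates from \<open>n\<close> equidistant
  nodes that are already covered and costs a factor \<open>2 ^ n + 1\<close>. The total factor
  depends on the number of strides only, not on \<open>h\<close>.\<close>

lemma extrapolation_bound:
  fixes D :: "nat \<Rightarrow> real \<Rightarrow> real"
  assumes "0 < n" "0 < h" "0 \<le> M" "0 \<le> \<delta>"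
    and deriv: "\<And>i t. i < n \<Longrightarrow> t \<in> {A..B} \<Longrightarrow> (D i has_real_derivative D (Suc i) t) (at t within {A..B})"
    and top: "\<And>t. t \<in> {A..B} \<Longrightarrow> \<bar>D n t\<bar> \<le> M"
    and start: "\<And>t. t \<in> {A..A + h} \<Longrightarrow> \<bar>D 0 t\<bar> \<le> \<delta>"
  shows "t \<in> {A..B} \<Longrightarrow> t \<le> A + h + real m * (h / real n) \<Longrightarrow>
    \<bar>D 0 t\<bar> \<le> (2 ^ n + 1) ^ m * (\<delta> + M * h ^ n)"
proof (induction m arbitrary: t)
  case 0
  then have "\<bar>D 0 t\<bar> \<le> \<delta>" by (intro start) auto
  then show ?case using assms(1-4) by (simp add: add_increasing2)
next
  case (Suc m)
  define \<beta> where "\<beta> = (2 ^ n + 1) ^ m * (\<delta> + M * h ^ n)"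
  define \<eta> where "\<eta> = h / real n"
  have base: "0 \<le> \<delta> + M * h ^ n" using assms(1-4) by simp
  have ge1: "(1::real) \<le> (2 ^ n + 1) ^ m" by (rule one_le_power) simp
  have \<beta>_ge: "\<delta> + M * h ^ n \<le> \<beta>"
    using mult_right_mono[OF ge1 base] by (simp add: \<beta>_def)
  have "0 \<le> \<beta>" using base \<beta>_ge by linarith
  have \<eta>: "0 < \<eta>" "real n * \<eta> = h" "\<eta> \<le> h"
    using assms(1,2) by (auto simp: \<eta>_def field_simps)
  show ?case
  proof (cases "t \<le> A + h + real m * (h / real n)")
    case True
    then have "\<bar>D 0 t\<bar> \<le> \<beta>" using Suc by (simp add: \<beta>_def)
    also have "\<dots> \<le> (2 ^ n + 1) * \<beta>" using \<open>0 \<le> \<beta>\<close> by (simp add: algebra_simps)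
    finally show ?thesis by (simp add: \<beta>_def algebra_simps)
  next
    case False
    \<comment> \<open>The \<open>n + 1\<close> nodes of spacing \<open>h / n\<close> that end in
      \<open>t\<close> start here; since \<open>t\<close> lies beyond \<open>A + h\<close>, they do
      not leave the interval on the left.\<close>
    define x where "x = t - h"
    have "0 \<le> real m * (h / real n)" using \<open>0 < h\<close> by simp
    then have x: "A \<le> x" "x + real n * \<eta> = t"
      using False \<eta>(2) unfolding x_def by linarith+
    then have sub: "{x..x + real n * \<eta>} \<subseteq> {A..B}" using Suc.prems by auto
    have "\<bar>D 0 (x + real n * \<eta>)\<bar> \<le> M * \<eta> ^ n + (2 ^ n - 1) * \<beta>"
    proof (rule extrapolation_step[OF \<eta>(1)])
      fix i t' assume "i < n" "t' \<in> {x..x + real n * \<eta>}"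
      then show "(D i has_real_derivative D (Suc i) t') (at t' within {x..x + real n * \<eta>})"
        using deriv sub by (meson DERIV_subset subsetD)
    next
      fix t' assume "t' \<in> {x..x + real n * \<eta>}"
      then show "\<bar>D n t'\<bar> \<le> M" using top sub by blast
    next
      fix i assume "i < n"
      \<comment> \<open>All nodes before the last are at most \<open>t - \<eta>\<close>, that is,
        one stride back, within reach of the induction hypothesis.\<close>
      then have "real i * \<eta> \<le> (real n - 1) * \<eta>"
        using \<eta>(1) by (intro mult_right_mono) auto
      then have "x + real i * \<eta> \<le> t - \<eta>"
        using x(2) by (simp add: algebra_simps)
      moreover have "0 \<le> real i * \<eta>" using \<eta> by simp
      moreover have "t \<le> B" using Suc.prems(1) by simp
      moreover have "t - \<eta> \<le> A + h + real m * (h / real n)"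
        using Suc.prems(2) by (simp add: \<eta>_def algebra_simps add_divide_distrib)
      ultimately have "A \<le> x + real i * \<eta>" "x + real i * \<eta> \<le> B"
        "x + real i * \<eta> \<le> A + h + real m * (h / real n)"
        using x(1) \<eta>(1) by linarith+
      then show "\<bar>D 0 (x + real i * \<eta>)\<bar> \<le> \<beta>"
        unfolding \<beta>_def by (intro Suc.IH) simp_all
    qed
    moreover have "M * \<eta> ^ n \<le> \<beta>"
    proof -
      have "M * \<eta> ^ n \<le> M * h ^ n"
        using \<eta> assms by (intro mult_left_mono power_mono) auto
      then show ?thesis using \<beta>_ge assms(4) by linarith
    qed
    moreover have "(2 ^ n + 1) * \<beta> = \<beta> + (2 ^ n - 1) * \<beta> + \<beta>"
      by (simp add: algebra_simps)
    ultimately have "\<bar>D 0 t\<bar> \<le> (2 ^ n + 1) * \<beta>"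
      using x(2) \<open>0 \<le> \<beta>\<close> by simp
    then show ?thesis by (simp add: \<beta>_def algebra_simps)
  qed
qed

text \<open>A Gronwall inequality read backwards in time: \<open>exp (K * (x - s)) * f x\<close> has
  a non-negative derivative, so it does not decrease from \<open>s\<close> to
  \<open>t\<close>.\<close>

lemma le_exp_mult_of_deriv_ge:
  fixes f f' :: "real \<Rightarrow> real"
  assumes "s \<le> t"
    and deriv: "\<And>x. x \<in> {s..t} \<Longrightarrow> (f has_real_derivative f' x) (at x within {s..t})"
    and ge: "\<And>x. x \<in> {s..t} \<Longrightarrow> - K * f x \<le> f' x"
  shows "f s \<le> exp (K * (t - s)) * f t"
proof (cases "s = t")
  case False
  define g where "g x = exp (K * (x - s)) * f x" for x
  have "\<exists>x\<in>{s<..<t}. g t - g s = (\<lambda>d. exp (K * (x - s)) * (K * f x + f' x) * d) (t - s)"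
  proof (rule mvt_simple)
    fix x assume "s \<le> x" "x \<le> t"
    then have "(f has_real_derivative f' x) (at x within {s..t})" by (intro deriv) auto
    then have "(g has_real_derivative exp (K * (x - s)) * (K * f x + f' x)) (at x within {s..t})"
      unfolding g_def by (auto intro!: derivative_eq_intros simp: algebra_simps)
    then show "(g has_derivative (\<lambda>d. exp (K * (x - s)) * (K * f x + f' x) * d)) (at x within {s..t})"
      by (simp add: has_field_derivative_def)
  qed (use assms False in simp)
  then obtain x where x: "x \<in> {s<..<t}"
    "g t - g s = exp (K * (x - s)) * (K * f x + f' x) * (t - s)" by blast
  have "0 \<le> K * f x + f' x" using ge[of x] x(1) by simp
  then have "0 \<le> g t - g s" unfolding x(2) using assms by (intro mult_nonneg_nonneg) auto
  then show ?thesis by (simp add: g_def)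
qed simp

section \<open>Error of one corrector step\<close>

lemma matrix_vector_mult_sum_left: "(\<Sum>j\<in>J. A j) *v x = (\<Sum>j\<in>J. A j *v x)"
  for A :: "'a \<Rightarrow> real^'n^'m"
  by (induction J rule: infinite_finite_induct) (simp_all add: matrix_vector_mult_add_rdistrib)

lemma G_bar_mult_vector:
  "G_bar G s b c tn h \<epsilon> Y yp *v x =
    (\<Sum>j=1..s. b j *\<^sub>R (G (tn + c j * h) (clip (Y j)) *v (ratio_scaling \<epsilon> (Y j) yp *v x)))"
  by (simp add: G_bar_def matrix_vector_mult_sum_left matrix_vector_mul_assoc
      flip: scaleR_matrix_vector_assoc)

lemma ratio_scaling_mult_vector_nth:
  "(ratio_scaling \<epsilon> Y Z *v x) $ l = max (Y $ l) 0 / max (Z $ l) \<epsilon> * x $ l"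
proof -
  have "(ratio_scaling \<epsilon> Y Z *v x) $ l
      = (\<Sum>k\<in>UNIV. if k = l then max (Y $ k) 0 / max (Z $ k) \<epsilon> * x $ k else 0)"
    unfolding matrix_vector_mult_def ratio_scaling_def vec_lambda_beta
    by (rule sum.cong) auto
  then show ?thesis by simp
qed

lemma matrix_mult_ratio_scaling_nth:
  "(A ** ratio_scaling \<epsilon> Y Z) $ i $ k = A $ i $ k * (max (Y $ k) 0 / max (Z $ k) \<epsilon>)"
proof -
  have "(A ** ratio_scaling \<epsilon> Y Z) $ i $ k
      = (\<Sum>l\<in>UNIV. if l = k then A $ i $ k * (max (Y $ k) 0 / max (Z $ k) \<epsilon>) else 0)"
    unfolding matrix_matrix_mult_def ratio_scaling_def vec_lambda_beta
    by (rule sum.cong) auto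
  then show ?thesis by simp
qed

text \<open>Ratio scaling from the right multiplies whole columns by factors that are non-negative
  for \<open>\<epsilon> > 0\<close>. With non-negative weights, \<open>G_bar\<close> therefore
  inherits the sign pattern and the vanishing column sums of \<open>G\<close> at the clipped
  stages.\<close>

lemma G_bar_nth:
  "G_bar G s b c tn h \<epsilon> Y yp $ i $ k =
    (\<Sum>j=1..s. b j * (G (tn + c j * h) (clip (Y j)) $ i $ k * (max (Y j $ k) 0 / max (yp $ k) \<epsilon>)))"
  by (simp add: G_bar_def matrix_mult_ratio_scaling_nth)

lemma graph_laplacian_column_sum:
  fixes G :: "real \<Rightarrow> real^'d \<Rightarrow> real^'d^'d"
  assumes "graph_laplacian t0 G"
  shows "(\<Sum>i\<in>UNIV. G t x $ i $ k) = 0"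
proof -
  have "(\<chi> i. 1) v* G t x = 0"
    using assms unfolding graph_laplacian_def by (force dest: bspec[where x = 1])
  then show ?thesis by (simp add: vector_matrix_mult_def vec_eq_iff)
qed

text \<open>Above the threshold numerator and denominator cancel and leave the clipped stage value,
  which is off by at most \<open>\<beta>\<close>. Below it the stage value is only damped by a
  factor in \<open>[0, 1]\<close>, so the error is at most its own size, hence at most
  \<open>\<beta> + \<gamma>\<close>.\<close>

lemma ratio_scaling_error:
  fixes Y Z z :: "real^'n"
  assumes "0 < \<epsilon>" "0 \<le> z $ l" "\<bar>Y $ l - z $ l\<bar> \<le> \<beta>" "0 \<le> \<gamma>"
    and small: "Z $ l < \<epsilon> \<Longrightarrow> z $ l \<le> \<gamma>"
  shows "\<bar>(ratio_scaling \<epsilon> Y Z *v clip Z - Y) $ l\<bar> \<le> \<beta> + \<gamma>"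
proof (cases "Z $ l < \<epsilon>")
  case False
  then have "(ratio_scaling \<epsilon> Y Z *v clip Z) $ l = max (Y $ l) 0"
    using assms(1) by (simp add: ratio_scaling_mult_vector_nth clip_def)
  then show ?thesis using assms(2-4) by (auto simp: max_def abs_if split: if_splits)
next
  case True
  define \<theta> where "\<theta> = max (Z $ l) 0 / \<epsilon>"
  have \<theta>: "0 \<le> \<theta>" "\<theta> \<le> 1" using True assms(1) by (auto simp: \<theta>_def)
  have "(ratio_scaling \<epsilon> Y Z *v clip Z) $ l = \<theta> * max (Y $ l) 0"
    using True by (simp add: ratio_scaling_mult_vector_nth clip_def \<theta>_def)
  moreover have "\<bar>\<theta> * max (Y $ l) 0 - Y $ l\<bar> \<le> \<bar>Y $ l\<bar>"
  proof (cases "0 \<le> Y $ l")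
    case True
    then have "\<theta> * Y $ l \<le> 1 * Y $ l" "0 \<le> \<theta> * Y $ l"
      using \<theta> mult_right_mono[OF \<theta>(2) True] by auto
    then show ?thesis using True by simp
  qed (simp add: max_def)
  ultimately show ?thesis using assms small[OF True] by simp
qed

text \<open>The corrected value is compared with the clipped prediction: the ratio scaling acts on it with
  factors in \<open>[0, 1]\<close>, even where the prediction is negative and \<open>\<epsilon>\<close> is far smaller than its size.\<close>

lemma corrector_step_error:
  fixes G :: "real \<Rightarrow> real^'d \<Rightarrow> real^'d^'d" and yn z :: "real^'d" and Y Z :: "nat \<Rightarrow> real^'d"
    and b c :: "nat \<Rightarrow> real" and tn h :: real and s :: nat
  defines "d \<equiv> real CARD('d)"
  defines "yp \<equiv> predicted G s b c tn h yn Y"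
  assumes laplacian: "graph_laplacian t0 G" and weights: "\<And>j. j \<in> {1..s} \<Longrightarrow> 0 \<le> b j"
    and times: "\<And>j. j \<in> {1..s} \<Longrightarrow> t0 \<le> tn + c j * h"
    and "0 \<le> h" "0 < \<epsilon>"
    and corrector: "corrector_equation G s b c tn h \<epsilon> yn Y yp u"
    and z: "0 \<le> z" and Z: "\<And>j. j \<in> {1..s} \<Longrightarrow> 0 \<le> Z j"
    and \<alpha>: "norm (yp - z) \<le> \<alpha>"
    and \<beta>: "\<And>j. j \<in> {1..s} \<Longrightarrow> norm (Y j - Z j) \<le> \<beta>"
    and "0 \<le> \<gamma>" and \<gamma>: "\<And>j l. j \<in> {1..s} \<Longrightarrow> yp $ l < \<epsilon> \<Longrightarrow> Z j $ l \<le> \<gamma>"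
    and K: "\<And>j. j \<in> {1..s} \<Longrightarrow> norm (G (tn + c j * h) (clip (Y j))) \<le> K"
    and L: "\<And>j. j \<in> {1..s} \<Longrightarrow> norm (G (tn + c j * h) (clip (Y j)) - G (tn + c j * h) (Y j))
      \<le> L * norm (clip (Y j) - Y j)"
    and R: "\<And>j. j \<in> {1..s} \<Longrightarrow> norm (Y j) \<le> R" and "0 \<le> K" "0 \<le> L" "0 \<le> R"
  shows "norm (u - z) \<le> \<alpha> + d * (\<alpha> + h * (\<Sum>j=1..s. b j) * (K * (d * (\<beta> + \<gamma>)) + L * \<beta> * R))"
proof -
  define w where "w = clip yp"
  define A where "A = G_bar G s b c tn h \<epsilon> Y yp"
  define \<rho> where "\<rho> = K * (d * (\<beta> + \<gamma>)) + L * \<beta> * R"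
  define e where "e j = G (tn + c j * h) (clip (Y j)) *v (ratio_scaling \<epsilon> (Y j) yp *v w)
    - G (tn + c j * h) (Y j) *v Y j" for j
  \<comment> \<open>This is the defect \<open>yn + h A w - w\<close> of \<open>w\<close> in the
    corrector equation, with \<open>yn\<close> eliminated by the predictor formula.\<close>
  define r where "r = (yp - w) + h *\<^sub>R (\<Sum>j=1..s. b j *\<^sub>R e j)"
  have w_z: "norm (w - z) \<le> \<alpha>"
    using norm_clip_diff_le[of yp z] \<alpha> z by (simp add: w_def clip_eq_self)
  have yp_w: "norm (yp - w) \<le> \<alpha>"
    using norm_clip_diff_self_le[OF z, of yp] \<alpha> by (simp add: w_def norm_minus_commute)

  have error_eq: "u - w = r + h *\<^sub>R (A *v (u - w))"
  proof -
    have "u = yn + h *\<^sub>R (A *v u)"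
      using corrector by (simp add: corrector_equation_def A_def)
    moreover have "h *\<^sub>R (\<Sum>j=1..s. b j *\<^sub>R e j) = h *\<^sub>R (A *v w) - (yp - yn)"
      unfolding A_def G_bar_mult_vector e_def
      by (simp add: yp_def predicted_def scaleR_right_diff_distrib sum_subtractf)
    ultimately show ?thesis
      by (simp add: r_def matrix_vector_mult_diff_distrib scaleR_right_diff_distrib)
  qed
  have "(\<Sum>l\<in>UNIV. \<bar>(u - w) $ l\<bar>) \<le> (\<Sum>l\<in>UNIV. \<bar>r $ l\<bar>)"
  proof (rule l1_resolvent_le[OF \<open>0 \<le> h\<close> _ _ _ error_eq])
    have ratio: "0 \<le> max (Y j $ k) 0 / max (yp $ k) \<epsilon>" for j k
      using \<open>0 < \<epsilon>\<close> by simp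
    \<comment> \<open>The sign conditions on \<open>G\<close> are assumed at non-negative arguments;
      clipping the stages makes them available here.\<close>
    have diag: "G (tn + c j * h) (clip (Y j)) $ l $ l \<le> 0"
      and off: "l \<noteq> k \<Longrightarrow> 0 \<le> G (tn + c j * h) (clip (Y j)) $ l $ k" if "j \<in> {1..s}" for j l k
      using laplacian times[OF that] clip_nonneg[of "Y j"] unfolding graph_laplacian_def by auto
    show "A $ l $ l \<le> 0" for l
      unfolding A_def G_bar_nth
      by (intro sum_nonpos mult_nonneg_nonpos mult_nonpos_nonneg weights diag ratio)
    show "0 \<le> A $ l $ k" if "l \<noteq> k" for l k
      unfolding A_def G_bar_nth using that by (intro sum_nonneg mult_nonneg_nonneg weights off ratio)
    show "(\<Sum>l\<in>UNIV. A $ l $ k) = 0" for k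
      unfolding A_def G_bar_nth
      by (subst sum.swap) (simp only: graph_laplacian_column_sum[OF laplacian] mult_zero_left
          mult_zero_right sum.neutral_const flip: sum_distrib_left sum_distrib_right)
  qed
  also have "\<dots> \<le> (\<Sum>l\<in>(UNIV::'d set). \<alpha> + h * (\<Sum>j=1..s. b j) * \<rho>)"
  proof (rule sum_mono)
    fix l
    have "\<bar>e j $ l\<bar> \<le> \<rho>" if j: "j \<in> {1..s}" for j
    proof -
      let ?Gc = "G (tn + c j * h) (clip (Y j))" and ?G = "G (tn + c j * h) (Y j)"
      let ?x = "ratio_scaling \<epsilon> (Y j) yp *v w - Y j"
      have "norm ?x \<le> (\<Sum>k\<in>UNIV. \<bar>?x $ k\<bar>)" by (rule norm_le_l1_cart)
      also have "\<dots> \<le> (\<Sum>k\<in>(UNIV::'d set). \<beta> + \<gamma>)"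
      proof (rule sum_mono)
        fix k
        show "\<bar>?x $ k\<bar> \<le> \<beta> + \<gamma>"
          unfolding w_def
        proof (rule ratio_scaling_error[where z = "Z j"])
          show "0 \<le> Z j $ k" using Z[OF j] by (simp add: less_eq_vec_def)
          show "\<bar>Y j $ k - Z j $ k\<bar> \<le> \<beta>"
            using component_le_norm_cart[of "Y j - Z j" k] \<beta>[OF j] by simp
        qed (use \<open>0 < \<epsilon>\<close> \<open>0 \<le> \<gamma>\<close> \<gamma>[OF j] in auto)
      qed
      also have "\<dots> = d * (\<beta> + \<gamma>)" by (simp add: d_def)
      finally have x: "norm ?x \<le> d * (\<beta> + \<gamma>)" .
      \<comment> \<open>The defect has two sources: the scaled prediction differs from the stage,
        and the matrix is evaluated at the clipped instead of the original stage.\<close>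
      have "e j = ?Gc *v ?x + (?Gc - ?G) *v Y j"
        by (simp add: e_def matrix_vector_mult_diff_distrib matrix_vector_mult_diff_rdistrib)
      then have "\<bar>e j $ l\<bar> \<le> \<bar>(?Gc *v ?x) $ l\<bar> + \<bar>((?Gc - ?G) *v Y j) $ l\<bar>" by simp
      also have "\<dots> \<le> norm ?Gc * norm ?x + norm (?Gc - ?G) * norm (Y j)"
        by (intro add_mono matrix_vector_component_le)
      also have "\<dots> \<le> K * (d * (\<beta> + \<gamma>)) + L * \<beta> * R"
      proof (intro add_mono mult_mono K j x R)
        have "norm (clip (Y j) - Y j) \<le> \<beta>"
          using norm_clip_diff_self_le[OF Z[OF j], of "Y j"] \<beta>[OF j] by simp
        then show "norm (?Gc - ?G) \<le> L * \<beta>"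
          using L[OF j] \<open>0 \<le> L\<close> by (meson mult_left_mono order_trans)
        then show "0 \<le> L * \<beta>" by (meson norm_ge_zero order_trans)
      qed (use \<open>0 \<le> K\<close> in auto)
      finally show ?thesis by (simp add: \<rho>_def)
    qed
    then have "\<bar>\<Sum>j=1..s. b j * e j $ l\<bar> \<le> (\<Sum>j=1..s. b j * \<rho>)"
      by (intro order_trans[OF sum_abs] sum_mono) (simp add: abs_mult weights mult_left_mono)
    then have "h * \<bar>\<Sum>j=1..s. b j * e j $ l\<bar> \<le> h * (\<Sum>j=1..s. b j) * \<rho>"
      using \<open>0 \<le> h\<close> by (simp add: mult_left_mono sum_distrib_right mult.assoc)
    moreover have "\<bar>r $ l\<bar> \<le> \<bar>(yp - w) $ l\<bar> + h * \<bar>\<Sum>j=1..s. b j * e j $ l\<bar>"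
      using \<open>0 \<le> h\<close> abs_triangle_ineq[of "(yp - w) $ l" "h * (\<Sum>j=1..s. b j * e j $ l)"]
      by (simp add: r_def abs_mult)
    moreover have "\<bar>(yp - w) $ l\<bar> \<le> \<alpha>"
      using component_le_norm_cart[of "yp - w" l] yp_w by simp
    ultimately show "\<bar>r $ l\<bar> \<le> \<alpha> + h * (\<Sum>j=1..s. b j) * \<rho>" by simp
  qed
  also have "\<dots> = d * (\<alpha> + h * (\<Sum>j=1..s. b j) * \<rho>)" by (simp add: d_def)
  finally have "norm (u - w) \<le> d * (\<alpha> + h * (\<Sum>j=1..s. b j) * \<rho>)"
    using norm_le_l1_cart[of "u - w"] by simp
  then show ?thesis
    using w_z norm_triangle_ineq[of "u - w" "w - z"] by (simp add: \<rho>_def)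
qed

section \<open>Uniform bounds along the exact solution\<close>

lemma C1_on_imp_continuous_on:
  assumes "C1_on f S"
  shows "continuous_on S f"
  using assms unfolding C1_on_def
  by (meson continuous_on_eq_continuous_within has_derivative_continuous)

text \<open>Compactness bounds the continuous derivative, and convexity keeps segments inside
  \<open>X\<close>, as the mean value inequality demands.\<close>

lemma C1_on_imp_lipschitz_on_compact_convex:
  assumes "C1_on f S" "compact X" "convex X" "X \<subseteq> S"
  obtains L where "0 \<le> L" "\<And>x y. x \<in> X \<Longrightarrow> y \<in> X \<Longrightarrow> norm (f x - f y) \<le> L * norm (x - y)"
proof -
  obtain f' where f': "continuous_on S f'"
    "\<And>x. x \<in> S \<Longrightarrow> (f has_derivative blinfun_apply (f' x)) (at x within S)"
    using assms(1) unfolding C1_on_def by blast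
  have "bounded (f' ` X)"
    using assms f'(1) by (intro compact_imp_bounded compact_continuous_image)
      (auto intro: continuous_on_subset)
  then obtain L where L: "0 < L" "\<And>x. x \<in> X \<Longrightarrow> norm (f' x) \<le> L"
    by (auto simp: bounded_pos)
  have "norm (f x - f y) \<le> L * norm (x - y)" if "x \<in> X" "y \<in> X" for x y
  proof (rule differentiable_bound[OF \<open>convex X\<close>])
    fix z assume "z \<in> X"
    then show "(f has_derivative blinfun_apply (f' z)) (at z within X)"
      using f'(2) assms(4) by (meson has_derivative_subset subsetD)
    show "onorm (blinfun_apply (f' z)) \<le> L"
      using L(2)[OF \<open>z \<in> X\<close>] by (simp add: norm_blinfun.rep_eq)
  qed (use that in auto)
  then show thesis using L(1) by (intro that[of L]) auto
qed

lemma exact_solution_imp_continuous_on: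
  assumes "exact_solution t0 G y0 y" "S \<subseteq> {t0..}"
  shows "continuous_on S y"
proof -
  have "continuous_on {t0..} y"
    unfolding continuous_on_eq_continuous_within
  proof
    fix t assume "t \<in> {t0..}"
    then have "(y has_vector_derivative (G t (y t) *v y t)) (at t within {t0..})"
      using assms(1) by (simp add: exact_solution_def)
    then show "continuous (at t within {t0..}) y" by (rule has_vector_derivative_continuous)
  qed
  then show ?thesis using assms(2) by (rule continuous_on_subset)
qed

text \<open>Along a non-negative solution the off-diagonal terms only feed a component, so it decays
  no faster than its diagonal entry allows. Compactness of the time interval bounds that entry by
  one \<open>K\<close>, and a component that is small later must have been small before.\<close>

lemma solution_component_le_later:
  fixes G :: "real \<Rightarrow> real^'d \<Rightarrow> real^'d^'d"
  assumes laplacian: "graph_laplacian t0 G"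
    and G_cont: "continuous_on ({t0..} \<times> UNIV) (\<lambda>(t, x). G t x)"
    and solution: "exact_solution t0 G y0 y" and y_nonneg: "\<And>t. t0 \<le> t \<Longrightarrow> 0 \<le> y t"
  obtains E where "0 \<le> E"
    "\<And>l s t. t0 \<le> s \<Longrightarrow> s \<le> t \<Longrightarrow> t \<le> T \<Longrightarrow> y s $ l \<le> E * y t $ l"
proof -
  have deriv: "(y has_vector_derivative (G t (y t) *v y t)) (at t within {t0..})" if "t0 \<le> t" for t
    using solution that by (simp add: exact_solution_def)
  have y_cont: "continuous_on {t0..T} y"
    using solution by (rule exact_solution_imp_continuous_on) auto
  have "continuous_on {t0..T} (\<lambda>t. (\<lambda>(t, x). G t x) (t, y t))"
    by (rule continuous_on_compose2[OF G_cont]) (auto intro!: continuous_intros y_cont)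
  then have "bounded ((\<lambda>t. G t (y t)) ` {t0..T})"
    by (intro compact_imp_bounded compact_continuous_image) auto
  then obtain K where K: "0 < K" "\<And>t. t \<in> {t0..T} \<Longrightarrow> norm (G t (y t)) \<le> K"
    by (auto simp: bounded_pos)
  show thesis
  proof (rule that)
    fix l s t assume st: "t0 \<le> s" "s \<le> t" "t \<le> T"
    have "y s $ l \<le> exp (K * (t - s)) * y t $ l"
    proof (rule le_exp_mult_of_deriv_ge[OF \<open>s \<le> t\<close>])
      fix x assume x: "x \<in> {s..t}"
      then have "(y has_vector_derivative (G x (y x) *v y x)) (at x within {s..t})"
        using st by (intro has_vector_derivative_within_subset[OF deriv]) auto
      then have "((\<lambda>x. y x $ l) has_vector_derivative (G x (y x) *v y x) $ l) (at x within {s..t})"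
        by (rule bounded_linear.has_vector_derivative[OF bounded_linear_vec_nth])
      then show "((\<lambda>x. y x $ l) has_real_derivative (G x (y x) *v y x) $ l) (at x within {s..t})"
        by (simp add: has_real_derivative_iff_has_vector_derivative)
      have nonneg: "0 \<le> y x $ k" for k
        using y_nonneg[of x] x st by (simp add: less_eq_vec_def)
      have off: "0 \<le> G x (y x) $ l $ k" if "k \<noteq> l" for k
        using laplacian y_nonneg[of x] x st that unfolding graph_laplacian_def by auto
      have "\<bar>G x (y x) $ l $ l\<bar> \<le> K"
        using K(2)[of x] x st Finite_Cartesian_Product.norm_nth_le[of "G x (y x)" l]
          component_le_norm_cart[of "G x (y x) $ l" l] by auto
      then have "- K * y x $ l \<le> G x (y x) $ l $ l * y x $ l"
        by (intro mult_right_mono nonneg) auto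
      also have "\<dots> \<le> (\<Sum>k\<in>UNIV. G x (y x) $ l $ k * y x $ k)"
        by (simp add: sum.remove[of UNIV l]) (intro sum_nonneg mult_nonneg_nonneg nonneg off, simp)
      finally show "- K * y x $ l \<le> (G x (y x) *v y x) $ l"
        by (simp add: matrix_vector_mult_def)
    qed
    also have "\<dots> \<le> exp (K * (T - t0)) * y t $ l"
      using st K(1) y_nonneg[of t] by (intro mult_right_mono) (auto simp: less_eq_vec_def)
    finally show "y s $ l \<le> exp (K * (T - t0)) * y t $ l" .
  qed simp
qed

text \<open>This transfers smallness from the end of a step to the stage times, with one constant
  for all components, starting times and step sizes.\<close>

lemma component_extrapolation_bound:
  fixes y :: "real \<Rightarrow> real^'d"
  assumes "Ck_curve_on n y {t0..}" "0 < n" "0 \<le> E"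
    and nonneg: "\<And>t. t0 \<le> t \<Longrightarrow> 0 \<le> y t"
    and le_later: "\<And>l s t. t0 \<le> s \<Longrightarrow> s \<le> t \<Longrightarrow> t \<le> T \<Longrightarrow> y s $ l \<le> E * y t $ l"
  obtains C where "0 \<le> C"
    "\<And>tn h t l. t0 \<le> tn \<Longrightarrow> 0 < h \<Longrightarrow> tn + h \<le> T \<Longrightarrow> t0 \<le> t \<Longrightarrow> t \<le> T \<Longrightarrow> t \<le> tn + \<kappa> * h
      \<Longrightarrow> y t $ l \<le> C * (y (tn + h) $ l + h ^ n)"
proof -
  obtain D where D: "\<And>t. t0 \<le> t \<Longrightarrow> D 0 t = y t"
    "\<And>i t. i < n \<Longrightarrow> t0 \<le> t \<Longrightarrow> (D i has_vector_derivative D (Suc i) t) (at t within {t0..})"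
    "continuous_on {t0..} (D n)"
    using assms(1) unfolding Ck_curve_on_def by auto
  have "bounded (D n ` {t0..T})"
    by (intro compact_imp_bounded compact_continuous_image continuous_on_subset[OF D(3)]) auto
  then obtain M where M: "0 < M" "\<And>t. t \<in> {t0..T} \<Longrightarrow> norm (D n t) \<le> M"
    by (auto simp: bounded_pos)
  \<comment> \<open>Number of strides of length \<open>h / n\<close> that cover the distance
    \<open>\<kappa> * h\<close>; the step size cancels.\<close>
  define m where "m = nat \<lceil>\<kappa> * real n\<rceil>"
  have m: "\<kappa> * h \<le> real m * (h / real n)" if "0 < h" for h
  proof -
    have "\<kappa> * real n \<le> real m" unfolding m_def by linarith
    then have "\<kappa> * real n * (h / real n) \<le> real m * (h / real n)"
      using that by (intro mult_right_mono) auto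
    then show ?thesis using \<open>0 < n\<close> by simp
  qed
  define F :: real where "F = (2 ^ n + 1) ^ m"
  have F: "1 \<le> F" unfolding F_def by (rule one_le_power) simp
  show thesis
  proof (rule that[of "F * (E + M)"])
    show "0 \<le> F * (E + M)" using F \<open>0 \<le> E\<close> M(1) by simp
  next
    fix tn h t l
    assume t: "t0 \<le> tn" "0 < h" "tn + h \<le> T" "t0 \<le> t" "t \<le> T" "t \<le> tn + \<kappa> * h"
    let ?\<delta> = "y (tn + h) $ l"
    have \<delta>: "0 \<le> ?\<delta>" using nonneg[of "tn + h"] t by (simp add: less_eq_vec_def)
    have "y t $ l \<le> F * (E * ?\<delta> + M * h ^ n)"
    \<comment> \<open>An abscissa may be negative. A time before \<open>tn\<close> is covered by the
      backward estimate alone; from \<open>tn\<close> on, that estimate supplies the initial bound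
      on \<open>{tn..tn + h}\<close> for the extrapolation.\<close>
    proof (cases "t < tn")
      case True
      then have "y t $ l \<le> E * ?\<delta>" using t by (intro le_later) auto
      also have "\<dots> \<le> E * ?\<delta> + M * h ^ n" using M(1) t by simp
      also have "\<dots> \<le> F * (E * ?\<delta> + M * h ^ n)"
        using mult_right_mono[OF F, of "E * ?\<delta> + M * h ^ n"] \<delta> \<open>0 \<le> E\<close> M(1) t by simp
      finally show ?thesis .
    next
      case False
      have "\<bar>D 0 t $ l\<bar> \<le> (2 ^ n + 1) ^ m * (E * ?\<delta> + M * h ^ n)"
      proof (rule extrapolation_bound[where D = "\<lambda>i x. D i x $ l" and A = tn and B = T])
        fix i x assume "i < n" "x \<in> {tn..T}"
        then have "(D i has_vector_derivative D (Suc i) x) (at x within {tn..T})"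
          using t by (intro has_vector_derivative_within_subset[OF D(2)]) auto
        then have "((\<lambda>x. D i x $ l) has_vector_derivative D (Suc i) x $ l) (at x within {tn..T})"
          by (rule bounded_linear.has_vector_derivative[OF bounded_linear_vec_nth])
        then show "((\<lambda>x. D i x $ l) has_real_derivative D (Suc i) x $ l) (at x within {tn..T})"
          by (simp add: has_real_derivative_iff_has_vector_derivative)
      next
        fix x assume "x \<in> {tn..T}"
        then show "\<bar>D n x $ l\<bar> \<le> M"
          using M(2)[of x] t component_le_norm_cart[of "D n x" l] by simp
      next
        fix x assume x: "x \<in> {tn..tn + h}"
        then have "y x $ l \<le> E * ?\<delta>" using t by (intro le_later) auto
        then show "\<bar>D 0 x $ l\<bar> \<le> E * ?\<delta>"
          using D(1)[of x] nonneg[of x] x t by (simp add: less_eq_vec_def)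
      next
        show "t \<le> tn + h + real m * (h / real n)" using t m[of h] by linarith
      qed (use t \<delta> M(1) \<open>0 \<le> E\<close> \<open>0 < n\<close> False in auto)
      then show ?thesis using D(1) t by (simp add: F_def)
    qed
    also have "\<dots> \<le> F * ((E + M) * (?\<delta> + h ^ n))"
    proof (rule mult_left_mono)
      have "0 \<le> E * h ^ n" "0 \<le> M * ?\<delta>" using \<open>0 \<le> E\<close> M(1) \<delta> t by auto
      then show "E * ?\<delta> + M * h ^ n \<le> (E + M) * (?\<delta> + h ^ n)" by (simp add: algebra_simps)
    qed (use F in simp)
    finally show "y t $ l \<le> F * (E + M) * (?\<delta> + h ^ n)" by (simp add: mult.assoc)
  qed
qed

section \<open>Asymptotics of steps\<close>

lemma eventually_steps_small: "\<forall>\<^sub>F (tn, h) in steps TN. tn \<in> TN \<and> 0 < h \<and> h \<le> 1"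
  unfolding steps_def eventually_prod_filter
proof (intro exI conjI allI impI)
  show "\<forall>\<^sub>F tn in principal TN. tn \<in> TN" by (simp add: eventually_principal)
  show "\<forall>\<^sub>F h in at_right 0. 0 < h \<and> h \<le> (1::real)"
    unfolding eventually_at_right_field by (intro exI[of _ 1]) auto
qed simp

text \<open>This permits substituting a threshold tied to the step size into an estimate with
  independent \<open>h\<close> and \<open>\<epsilon>\<close>: for \<open>C > 0\<close> and
  \<open>m > 0\<close> the threshold is positive and tends to 0 with \<open>h\<close>.\<close>

lemma filterlim_steps_threshold:
  assumes "0 < C" "0 < m"
  shows "filterlim (\<lambda>(tn, h). ((tn, h), C * h ^ m)) (steps TN \<times>\<^sub>F at_right 0) (steps TN)"
proof -
  have "filterlim (\<lambda>h. C * h ^ m) (at_right 0) (at_right (0::real))"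
    unfolding filterlim_at
  proof
    show "\<forall>\<^sub>F h in at_right 0. C * h ^ m \<in> {0<..} \<and> C * h ^ m \<noteq> 0"
      using eventually_at_right_less[of "0::real"] by eventually_elim (use \<open>0 < C\<close> in auto)
    show "((\<lambda>h. C * h ^ m) \<longlongrightarrow> 0) (at_right 0)"
      by (rule tendsto_eq_intros | simp add: \<open>0 < m\<close>)+
  qed
  then have "filterlim (\<lambda>x. C * snd x ^ m) (at_right 0) (steps TN)"
    unfolding steps_def by (rule filterlim_compose[OF _ filterlim_snd])
  then show ?thesis
    unfolding case_prod_beta by (intro filterlim_Pair) (simp_all add: filterlim_ident)
qed

lemma bigo_steps_obtain_bound:
  assumes "(\<lambda>(tn, h). norm (f tn h)) \<in> O[steps TN](\<lambda>(tn, h). h ^ k)"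
  obtains C where "0 < C" "\<forall>\<^sub>F (tn, h) in steps TN. norm (f tn h) \<le> C * h ^ k"
proof -
  obtain C where C: "0 < C" "\<forall>\<^sub>F x in steps TN. norm ((\<lambda>(tn, h). norm (f tn h)) x)
      \<le> C * norm ((\<lambda>(tn, h). h ^ k) x)"
    using assms by (rule landau_o.bigE)
  have "\<forall>\<^sub>F (tn, h) in steps TN. norm (f tn h) \<le> C * h ^ k"
    using C(2) eventually_steps_small[of TN] by eventually_elim (auto simp: power_abs)
  with C(1) show thesis by (rule that)
qed

lemma stage_order_obtain_bound:
  assumes "stage_order TN y s c Y q"
  obtains C where "0 < C"
    "\<forall>\<^sub>F (tn, h) in steps TN. \<forall>i\<in>{1..s}. norm (Y tn h i - y (tn + c i * h)) \<le> C * h ^ (q + 1)"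
proof -
  have "\<forall>i\<in>{1..s}. \<exists>C. 0 < C \<and>
    (\<forall>\<^sub>F (tn, h) in steps TN. norm (Y tn h i - y (tn + c i * h)) \<le> C * h ^ (q + 1))"
  proof
    fix i assume "i \<in> {1..s}"
    then have "(\<lambda>(tn, h). norm (Y tn h i - y (tn + c i * h))) \<in> O[steps TN](\<lambda>(tn, h). h ^ (q + 1))"
      using assms unfolding stage_order_def by simp
    from bigo_steps_obtain_bound[OF this]
    show "\<exists>C. 0 < C \<and>
      (\<forall>\<^sub>F (tn, h) in steps TN. norm (Y tn h i - y (tn + c i * h)) \<le> C * h ^ (q + 1))"
      by blast
  qed
  from bchoice[OF this] obtain C where C: "\<And>i. i \<in> {1..s} \<Longrightarrow> 0 < C i"
    "\<And>i. i \<in> {1..s} \<Longrightarrow>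
      \<forall>\<^sub>F (tn, h) in steps TN. norm (Y tn h i - y (tn + c i * h)) \<le> C i * h ^ (q + 1)"
    by blast
  \<comment> \<open>The sum dominates the constants of all stages; the summand 1 keeps it positive
    even for \<open>s = 0\<close>.\<close>
  define C' where "C' = 1 + (\<Sum>i=1..s. C i)"
  have le: "C i \<le> C'" if "i \<in> {1..s}" for i
    using member_le_sum[of i "{1..s}" C] that C(1) by (force simp: C'_def)
  have "0 < C'"
    using sum_nonneg[of "{1..s}" C] C(1) by (force simp: C'_def)
  moreover have "\<forall>\<^sub>F x in steps TN. \<forall>i\<in>{1..s}.
      case x of (tn, h) \<Rightarrow> norm (Y tn h i - y (tn + c i * h)) \<le> C i * h ^ (q + 1)"
    using C(2) by (intro eventually_ball_finite) auto
  then have "\<forall>\<^sub>F (tn, h) in steps TN. \<forall>i\<in>{1..s}.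
      norm (Y tn h i - y (tn + c i * h)) \<le> C' * h ^ (q + 1)"
    using eventually_steps_small[of TN]
  proof eventually_elim
    case (elim x)
    obtain tn h where [simp]: "x = (tn, h)" by (cases x)
    show ?case
    proof (simp, intro ballI)
      fix i assume i: "i \<in> {Suc 0..s}"
      then have "norm (Y tn h i - y (tn + c i * h)) \<le> C i * h ^ (q + 1)" using elim by auto
      also have "\<dots> \<le> C' * h ^ (q + 1)" using elim le[of i] i by (intro mult_right_mono) auto
      finally show "norm (Y tn h i - y (tn + c i * h)) \<le> C' * (h * h ^ q)" by simp
    qed
  qed
  ultimately show thesis by (rule that)
qed

section \<open>Local error and order of the corrected solution\<close>

theorem proposition3p23:
  fixes G :: "real \<Rightarrow> real^'d \<Rightarrow> real^'d^'d"
    and t0 T :: real and TN :: "real set"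
    and y0 :: "real^'d" and y :: "real \<Rightarrow> real^'d"
    and s p q :: nat and a :: "nat \<Rightarrow> nat \<Rightarrow> real" and b c :: "nat \<Rightarrow> real"
    and Y :: "real \<Rightarrow> real \<Rightarrow> nat \<Rightarrow> real^'d"
    and yp :: "real \<Rightarrow> real \<Rightarrow> real^'d"
    and u :: "real \<Rightarrow> real \<Rightarrow> real \<Rightarrow> real^'d"
  assumes laplacian: "graph_laplacian t0 G"
    and G_smooth: "C1_on (\<lambda>(t, x). G t x) ({t0..} \<times> UNIV)"
    and solution: "exact_solution t0 G y0 y" and initial: "0 \<le> y0"
    and y_nonneg: "\<forall>t\<ge>t0. 0 \<le> y t"
    and y_smooth: "Ck_curve_on (max p q + 1) y {t0..}"
    and sdirk: "sdirk s a b" and weights: "\<forall>j\<in>{1..s}. 0 \<le> b j"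
    and start_times: "TN \<subseteq> {t0..T}"
    and stage_times: "\<forall>\<^sub>F (tn, h) in steps TN. \<forall>i\<in>{1..s}. t0 \<le> tn + c i * h"
    and stages: "\<forall>\<^sub>F (tn, h) in steps TN. stage_equations G s a c tn h (y tn) (Y tn h)"
    and stages_limit: "\<forall>i\<in>{1..s}. ((\<lambda>(tn, h). Y tn h i - y tn) \<longlongrightarrow> 0) (steps TN)"
    and predictor: "yp = (\<lambda>tn h. predicted G s b c tn h (y tn) (Y tn h))"
    and order: "local_order TN y yp p"
    and stage_order: "stage_order TN y s c Y q"
    and corrector: "\<forall>\<^sub>F ((tn, h), \<epsilon>) in steps TN \<times>\<^sub>F at_right 0.
      corrector_equation G s b c tn h \<epsilon> (y tn) (Y tn h) (yp tn h) (u tn h \<epsilon>)"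
  shows "(\<lambda>((tn, h), \<epsilon>). norm (u tn h \<epsilon> - y (tn + h)))
           \<in> O[steps TN \<times>\<^sub>F at_right 0](\<lambda>((tn, h), \<epsilon>). h ^ min (q + 2) (p + 1) + \<epsilon>) \<and>
         (\<forall>C>0. local_order TN y (\<lambda>tn h. u tn h (C * h ^ min (q + 2) (p + 1))) (min p (q + 1)))"
proof -
  \<comment> \<open>\<open>m\<close> is the exponent of the error bound and \<open>N\<close> the
    number of derivatives of \<open>y\<close>; as \<open>N \<ge> p + 1 \<ge> m\<close>, the
    extrapolation remainder \<open>h ^ N\<close> is small enough. No end point or stage time exceeds
    \<open>T'\<close> as long as \<open>h \<le> 1\<close>.\<close>
  define m where "m = min (q + 2) (p + 1)"
  define N where "N = max p q + 1"
  define \<kappa> where "\<kappa> = (\<Sum>j=1..s. \<bar>c j\<bar>)"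
  define T' where "T' = T + 1 + \<kappa>"
  define d where "d = real CARD('d)"
  define B where "B = (\<Sum>j=1..s. b j)"
  have "0 < N" by (simp add: N_def)
  have "0 \<le> \<kappa>" by (simp add: \<kappa>_def sum_nonneg)
  have "0 \<le> B" using weights unfolding B_def by (intro sum_nonneg) blast
  have c_le: "c j \<le> \<kappa>" if "j \<in> {1..s}" for j
    using member_le_sum[of j "{1..s}" "\<lambda>j. \<bar>c j\<bar>"] that by (simp add: \<kappa>_def)
  have time_le: "tn + x * h \<le> T'" if "tn \<in> TN" "x \<le> \<kappa> + 1" "0 < h" "h \<le> 1" for tn x h
  proof -
    have "x * h \<le> (\<kappa> + 1) * h" using that by (intro mult_right_mono) auto
    also have "\<dots> \<le> (\<kappa> + 1) * 1" using that \<open>0 \<le> \<kappa>\<close> by (intro mult_left_mono) auto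
    finally show ?thesis using that(1) start_times by (auto simp: T'_def)
  qed

  obtain C1 where C1: "0 < C1"
    "\<forall>\<^sub>F (tn, h) in steps TN. norm (yp tn h - y (tn + h)) \<le> C1 * h ^ (p + 1)"
    using bigo_steps_obtain_bound[OF order[unfolded local_order_def]] by blast
  obtain C2 where C2: "0 < C2"
    "\<forall>\<^sub>F (tn, h) in steps TN. \<forall>i\<in>{1..s}. norm (Y tn h i - y (tn + c i * h)) \<le> C2 * h ^ (q + 1)"
    using stage_order_obtain_bound[OF stage_order] by blast

  have y_nonneg': "0 \<le> y t" if "t0 \<le> t" for t using y_nonneg that by blast
  obtain E where E: "0 \<le> E"
    "\<And>l s t. t0 \<le> s \<Longrightarrow> s \<le> t \<Longrightarrow> t \<le> T' \<Longrightarrow> y s $ l \<le> E * y t $ l"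
    using solution_component_le_later[OF laplacian C1_on_imp_continuous_on[OF G_smooth] solution
        y_nonneg'] by blast
  obtain C3 where C3: "0 \<le> C3"
    "\<And>tn h t l. t0 \<le> tn \<Longrightarrow> 0 < h \<Longrightarrow> tn + h \<le> T' \<Longrightarrow> t0 \<le> t \<Longrightarrow> t \<le> T' \<Longrightarrow> t \<le> tn + \<kappa> * h
      \<Longrightarrow> y t $ l \<le> C3 * (y (tn + h) $ l + h ^ N)"
    using component_extrapolation_bound[where T = T' and \<kappa> = \<kappa>,
        OF y_smooth[folded N_def] \<open>0 < N\<close> E(1) y_nonneg' E(2)] by blast

  have "bounded (y ` {t0..T'})"
    using exact_solution_imp_continuous_on[OF solution]
    by (intro compact_imp_bounded compact_continuous_image) auto
  then obtain R0 where R0: "0 < R0" "\<And>t. t \<in> {t0..T'} \<Longrightarrow> norm (y t) \<le> R0"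
    by (auto simp: bounded_pos)
  \<comment> \<open>For \<open>h \<le> 1\<close> the stage errors are at most \<open>C2\<close>, so
    the stages, and with them the clipped stages, stay in the ball of radius
    \<open>R\<close>.\<close>
  define R where "R = R0 + C2"
  have "0 < R" using R0(1) C2(1) by (simp add: R_def)
  define X where "X = {t0..T'} \<times> cball (0::real^'d) R"
  have X: "compact X" "convex X" "X \<subseteq> {t0..} \<times> UNIV"
    by (auto simp: X_def intro: compact_Times convex_Times)
  obtain L where L: "0 \<le> L" "\<And>v w. v \<in> X \<Longrightarrow> w \<in> X \<Longrightarrow>
      norm ((\<lambda>(t, x). G t x) v - (\<lambda>(t, x). G t x) w) \<le> L * norm (v - w)"
    using C1_on_imp_lipschitz_on_compact_convex[OF G_smooth X] by blast
  have "bounded ((\<lambda>(t, x). G t x) ` X)"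
    using X by (intro compact_imp_bounded compact_continuous_image
        continuous_on_subset[OF C1_on_imp_continuous_on[OF G_smooth]])
  then obtain K where K: "0 < K" "\<And>v. v \<in> X \<Longrightarrow> norm ((\<lambda>(t, x). G t x) v) \<le> K"
    unfolding bounded_pos by blast

  define C where "C = C1 + d * (C1 + B * (K * (d * (C2 + C3 * (2 + C1))) + L * C2 * R))"
  \<comment> \<open>Everything that holds only eventually is collected here, so that the estimate of
    a single step is free of filters and its constant is uniform.\<close>
  define good where "good tn h \<longleftrightarrow> tn \<in> TN \<and> 0 < h \<and> h \<le> 1 \<and> (\<forall>i\<in>{1..s}. t0 \<le> tn + c i * h) \<and>
      norm (yp tn h - y (tn + h)) \<le> C1 * h ^ (p + 1) \<and>
      (\<forall>i\<in>{1..s}. norm (Y tn h i - y (tn + c i * h)) \<le> C2 * h ^ (q + 1))" for tn h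
  have good: "\<forall>\<^sub>F x in steps TN. good (fst x) (snd x)"
    using eventually_steps_small[of TN] stage_times C1(2) C2(2)
    by eventually_elim (auto simp: good_def)
  have "0 \<le> d" by (simp add: d_def)

  have step: "norm (v - y (tn + h)) \<le> C * (h ^ m + \<epsilon>)"
    if "good tn h" "0 < \<epsilon>"
      and v: "corrector_equation G s b c tn h \<epsilon> (y tn) (Y tn h) (yp tn h) v" for tn h \<epsilon> v
  proof -
    define \<xi> where "\<xi> = h ^ m + \<epsilon>"
    define \<alpha> where "\<alpha> = C1 * h ^ (p + 1)"
    define \<beta> where "\<beta> = C2 * h ^ (q + 1)"
    \<comment> \<open>A predicted component below \<open>\<epsilon>\<close> forces the exact one at
      \<open>tn + h\<close> below \<open>\<epsilon> + \<alpha>\<close>; extrapolation to the stage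
      times adds \<open>h ^ N\<close> and the factor \<open>C3\<close>.\<close>
    define \<gamma> where "\<gamma> = C3 * ((\<epsilon> + \<alpha>) + h ^ N)"
    have tn: "tn \<in> TN" "t0 \<le> tn" and h: "0 < h" "h \<le> 1"
      and times: "\<And>j. j \<in> {1..s} \<Longrightarrow> t0 \<le> tn + c j * h"
      and yp: "norm (yp tn h - y (tn + h)) \<le> \<alpha>"
      and Y: "\<And>j. j \<in> {1..s} \<Longrightarrow> norm (Y tn h j - y (tn + c j * h)) \<le> \<beta>"
      using \<open>good tn h\<close> start_times by (auto simp: good_def \<alpha>_def \<beta>_def)
    have \<alpha>\<beta>\<gamma>: "0 \<le> \<alpha>" "0 \<le> \<beta>" "0 \<le> \<gamma>"
      using C1(1) C2(1) C3(1) h \<open>0 < \<epsilon>\<close> by (simp_all add: \<alpha>_def \<beta>_def \<gamma>_def)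
    have end_le: "tn + h \<le> T'" using time_le[of tn 1 h] tn h \<open>0 \<le> \<kappa>\<close> by simp
    have stage_le: "tn + c j * h \<le> T'" if "j \<in> {1..s}" for j
      using time_le[of tn "c j" h] c_le[OF that] tn h by simp
    have Y_le: "norm (Y tn h j) \<le> R" if "j \<in> {1..s}" for j
    proof -
      have "\<beta> \<le> C2 * 1"
        unfolding \<beta>_def using C2(1) h by (intro mult_left_mono power_le_one) auto
      moreover have "norm (y (tn + c j * h)) \<le> R0"
        using R0(2) times stage_le that by simp
      ultimately show ?thesis
        using Y[OF that] norm_triangle_sub[of "Y tn h j" "y (tn + c j * h)"] by (simp add: R_def)
    qed
    have in_X: "(tn + c j * h, clip (Y tn h j)) \<in> X" "(tn + c j * h, Y tn h j) \<in> X" if "j \<in> {1..s}" for j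
      using times[OF that] stage_le[OF that] Y_le[OF that] norm_clip_le[of "Y tn h j"]
      by (auto simp: X_def)

    have "norm (v - y (tn + h)) \<le> \<alpha> + d * (\<alpha> + h * B * (K * (d * (\<beta> + \<gamma>)) + L * \<beta> * R))"
      unfolding d_def B_def
    proof (rule corrector_step_error[where G = G and Z = "\<lambda>j. y (tn + c j * h)" and Y = "Y tn h",
          OF laplacian])
      show "corrector_equation G s b c tn h \<epsilon> (y tn) (Y tn h)
          (predicted G s b c tn h (y tn) (Y tn h)) v"
        and "norm (predicted G s b c tn h (y tn) (Y tn h) - y (tn + h)) \<le> \<alpha>"
        using v yp by (simp_all add: predictor)
    next
      fix j l assume j: "j \<in> {1..s}" and "predicted G s b c tn h (y tn) (Y tn h) $ l < \<epsilon>"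
      then have "y (tn + h) $ l \<le> \<epsilon> + \<alpha>"
        using yp component_le_norm_cart[of "yp tn h - y (tn + h)" l] by (simp add: predictor)
      then have "C3 * (y (tn + h) $ l + h ^ N) \<le> \<gamma>"
        unfolding \<gamma>_def using C3(1) by (intro mult_left_mono) auto
      moreover have "c j * h \<le> \<kappa> * h" using c_le[OF j] h by (intro mult_right_mono) auto
      ultimately show "y (tn + c j * h) $ l \<le> \<gamma>"
        using C3(2)[of tn h "tn + c j * h" l] tn h end_le times[OF j] stage_le[OF j] by simp
    next
      fix j assume j: "j \<in> {1..s}"
      show "norm (G (tn + c j * h) (clip (Y tn h j))) \<le> K"
        using K(2)[OF in_X(1)[OF j]] by simp
      show "norm (G (tn + c j * h) (clip (Y tn h j)) - G (tn + c j * h) (Y tn h j))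
          \<le> L * norm (clip (Y tn h j) - Y tn h j)"
        using L(2)[OF in_X[OF j]] by (simp add: norm_Pair)
    qed (use weights times h \<open>0 < \<epsilon>\<close> tn y_nonneg' Y Y_le \<alpha>\<beta>\<gamma> K(1) L(1) \<open>0 < R\<close> in auto)
    \<comment> \<open>The step size is moved onto the stage errors: \<open>h * \<beta>\<close> is of
      size \<open>h ^ (q + 2)\<close>, which is where the exponent \<open>q + 2\<close> comes
      from.\<close>
    also have "\<dots> = \<alpha> + d * (\<alpha> + B * (K * (d * (h * \<beta> + h * \<gamma>)) + L * (h * \<beta>) * R))"
      by (simp add: algebra_simps)
    also have "\<dots> \<le> C1 * \<xi> + d * (C1 * \<xi> + B * (K * (d * (C2 * \<xi> + C3 * (2 + C1) * \<xi>)) + L * (C2 * \<xi>) * R))"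
    proof -
      have pow: "h ^ k \<le> \<xi>" if "m \<le> k" for k
        using power_decreasing[OF that, of h] h \<open>0 < \<epsilon>\<close> by (simp add: \<xi>_def)
      have \<alpha>_le: "\<alpha> \<le> C1 * \<xi>"
        unfolding \<alpha>_def using C1(1) pow[of "p + 1"] by (intro mult_left_mono) (auto simp: m_def)
      have \<beta>_le: "h * \<beta> \<le> C2 * \<xi>"
        using C2(1) pow[of "q + 2"] mult_left_mono[of "h ^ (q + 2)" \<xi> C2]
        by (simp add: \<beta>_def m_def algebra_simps)
      have "h ^ N \<le> \<xi>" by (rule pow) (simp add: N_def m_def)
      moreover have "\<epsilon> \<le> \<xi>" using h by (simp add: \<xi>_def)
      \<comment> \<open>The threshold and the remainder contribute one \<open>\<xi>\<close> each,
        the predictor error \<open>C1 * \<xi>\<close>. Thus \<open>\<gamma>\<close> has the target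
        size already, and its factor \<open>h\<close> may be bounded by 1.\<close>
      ultimately have "\<epsilon> + \<alpha> + h ^ N \<le> (2 + C1) * \<xi>"
        using \<alpha>_le by (simp add: distrib_right)
      then have "\<gamma> \<le> C3 * (2 + C1) * \<xi>"
        unfolding \<gamma>_def using C3(1) by (simp add: mult_left_mono mult.assoc)
      moreover have "h * \<gamma> \<le> 1 * \<gamma>" using h \<alpha>\<beta>\<gamma> by (intro mult_right_mono) auto
      ultimately have \<gamma>_le: "h * \<gamma> \<le> C3 * (2 + C1) * \<xi>" by simp
      show ?thesis
        using K(1) L(1) \<open>0 < R\<close> \<open>0 \<le> B\<close> \<open>0 \<le> d\<close>
        by (intro add_mono mult_left_mono mult_right_mono \<alpha>_le \<beta>_le \<gamma>_le) auto
    qed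
    also have "\<dots> = C * \<xi>" by (simp add: C_def algebra_simps)
    finally show ?thesis by (simp add: \<xi>_def)
  qed

  \<comment> \<open>From the bound for one step to the asymptotic statements\<close>
  have "\<forall>\<^sub>F x in steps TN \<times>\<^sub>F at_right (0::real). good (fst (fst x)) (snd (fst x)) \<and> 0 < snd x"
    by (intro eventually_prodI good eventually_at_right_less)
  then have bound: "\<forall>\<^sub>F ((tn, h), \<epsilon>) in steps TN \<times>\<^sub>F at_right 0.
      0 < h \<and> 0 < \<epsilon> \<and> norm (u tn h \<epsilon> - y (tn + h)) \<le> C * (h ^ m + \<epsilon>)"
    using corrector
  proof eventually_elim
    case (elim x)
    obtain tn h \<epsilon> where x: "x = ((tn, h), \<epsilon>)" by (metis surj_pair)
    then have "norm (u tn h \<epsilon> - y (tn + h)) \<le> C * (h ^ m + \<epsilon>)"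
      using elim by (intro step) auto
    then show ?case using elim x by (simp add: good_def)
  qed
  have "(\<lambda>((tn, h), \<epsilon>). norm (u tn h \<epsilon> - y (tn + h)))
      \<in> O[steps TN \<times>\<^sub>F at_right 0](\<lambda>((tn, h), \<epsilon>). h ^ m + \<epsilon>)"
    by (rule bigoI[where c = C], rule eventually_mono[OF bound]) auto
  moreover have "local_order TN y (\<lambda>tn h. u tn h (A * h ^ m)) (min p (q + 1))" if "0 < A" for A
  proof -
    have "0 < m" by (simp add: m_def)
    have "\<forall>\<^sub>F (tn, h) in steps TN. 0 < h \<and>
        norm (u tn h (A * h ^ m) - y (tn + h)) \<le> C * (h ^ m + A * h ^ m)"
      using eventually_compose_filterlim[OF bound filterlim_steps_threshold[OF \<open>0 < A\<close> \<open>0 < m\<close>]]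
      by eventually_elim auto
    \<comment> \<open>Order \<open>r\<close> means local error exponent \<open>r + 1\<close>, hence
      the shift by one.\<close>
    moreover have "m = min p (q + 1) + 1" by (simp add: m_def)
    ultimately show ?thesis
      unfolding local_order_def
      by (intro bigoI[where c = "C * (1 + A)"], elim eventually_mono) (auto simp: algebra_simps)
  qed
  ultimately show ?thesis by (simp add: m_def)
qed

end
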